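(* (Newman's inequality for L-weakly dependent random variables) Let $n\ge 2$ and let $X_1,X_2,\ldots,X_n$ be centered real random variables that are L-weakly dependent with coefficients $\gamma_k\ge 0$, $k\geq 1$. Then, for every $t\in\mathbb{R}$, $$\left|\mathbb{E}\left(\prod_{j=1}^{n}e^{itX_j}\right)-\prod_{j=1}^{n}\mathbb{E}\left(e^{itX_j}\right)\right|\leq 4t^2\sum_{j=1}^{n-1}(n-j)\gamma_j .$$
   Context: L-weak dependence (finite family): real random variables $X_1,\ldots,X_n$ are L-weakly dependent with nonnegative coefficients $\gamma_k$, $k\ge1$, if for all disjoint subsets $I,J\subset\{1,\ldots,n\}$ and all real valued Lipschitz functions $f:\mathbb{R}^I\to\mathbb{R}$, $g:\mathbb{R}^J\to\mathbb{R}$, the covariance below is well defined and $$|\mathrm{Cov}(f(X_i,i\in I),g(X_j,j\in J))|\le \|f\|_L\|g\|_L\sum_{i\in I}\sum_{j\in J}\gamma_{|j-i|},$$ where $\|f\|_L=\sup_{x\neq y}\frac{|f(x)-f(y)|}{|x-y|}$ and $|x-y|=\sum_i|x_i-y_i|$ is the $\ell^1$ distance. *)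

theory Defs
  imports "HOL-Probability.Probability"
begin

text \<open>
  For a finite index set I, the space of real vectors indexed by I is represented by the
  extensional functions in PiE I UNIV. The library metric on functions is not the l1 distance,
  so the latter and the corresponding Lipschitz notions are introduced explicitly.
\<close>

definition l1_dist :: "nat set \<Rightarrow> (nat \<Rightarrow> real) \<Rightarrow> (nat \<Rightarrow> real) \<Rightarrow> real" where
  "l1_dist I x y = (\<Sum>i\<in>I. \<bar>x i - y i\<bar>)"

definition l1_lipschitz :: "nat set \<Rightarrow> ((nat \<Rightarrow> real) \<Rightarrow> real) \<Rightarrow> bool" where
  "l1_lipschitz I f \<longleftrightarrow>
     (\<exists>C. \<forall>x\<in>I \<rightarrow>\<^sub>E UNIV. \<forall>y\<in>I \<rightarrow>\<^sub>E UNIV. \<bar>f x - f y\<bar> \<le> C * l1_dist I x y)"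

text \<open>
  The supremum is taken in the nonnegative reals. Inserting 0 only matters if I is empty: then
  the space is a single point, there are no pairs of distinct vectors, and the seminorm is 0.
\<close>

definition lip_norm :: "nat set \<Rightarrow> ((nat \<Rightarrow> real) \<Rightarrow> real) \<Rightarrow> real" where
  "lip_norm I f = Sup (insert 0
     {\<bar>f x - f y\<bar> / l1_dist I x y | x y. x \<in> I \<rightarrow>\<^sub>E UNIV \<and> y \<in> I \<rightarrow>\<^sub>E UNIV \<and> x \<noteq> y})"

definition cov_defined :: "'a measure \<Rightarrow> ('a \<Rightarrow> real) \<Rightarrow> ('a \<Rightarrow> real) \<Rightarrow> bool" where
  "cov_defined M U V \<longleftrightarrow> integrable M U \<and> integrable M V \<and> integrable M (\<lambda>\<omega>. U \<omega> * V \<omega>)"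

definition cov :: "'a measure \<Rightarrow> ('a \<Rightarrow> real) \<Rightarrow> ('a \<Rightarrow> real) \<Rightarrow> real" where
  "cov M U V = (\<integral>\<omega>. (U \<omega> - (\<integral>\<xi>. U \<xi> \<partial>M)) * (V \<omega> - (\<integral>\<xi>. V \<xi> \<partial>M)) \<partial>M)"

text \<open>
  Only the coefficients with index at least 1 are relevant: for disjoint I and J the index
  |j - i| is never 0.
\<close>

definition L_weakly_dependent ::
  "'a measure \<Rightarrow> nat \<Rightarrow> (nat \<Rightarrow> 'a \<Rightarrow> real) \<Rightarrow> (nat \<Rightarrow> real) \<Rightarrow> bool" where
  "L_weakly_dependent M n X \<gamma> \<longleftrightarrow>
     (\<forall>I J f g. I \<subseteq> {1..n} \<longrightarrow> J \<subseteq> {1..n} \<longrightarrow> I \<inter> J = {} \<longrightarrow>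
        l1_lipschitz I f \<longrightarrow> l1_lipschitz J g \<longrightarrow>
        cov_defined M (\<lambda>\<omega>. f (\<lambda>i\<in>I. X i \<omega>)) (\<lambda>\<omega>. g (\<lambda>j\<in>J. X j \<omega>)) \<and>
        \<bar>cov M (\<lambda>\<omega>. f (\<lambda>i\<in>I. X i \<omega>)) (\<lambda>\<omega>. g (\<lambda>j\<in>J. X j \<omega>))\<bar>
          \<le> lip_norm I f * lip_norm J g * (\<Sum>i\<in>I. \<Sum>j\<in>J. \<gamma> (nat \<bar>int j - int i\<bar>)))"

end

theory Submission
  imports Defs
begin

text \<open>
  Factoring out one variable at a time and using that a characteristic function is bounded by 1,
  it suffices to bound the covariance of the exponential of the partial sum with the next
  exponential. Splitting both into cosine and sine gives four covariances of functions with
  Lipschitz seminorm at most the absolute value of t.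
\<close>

text \<open>Every quotient in the supremum is at most \<open>C\<close>, and the inserted 0 makes the
  set nonempty and gives the lower bound. Both bounds are needed later to multiply two seminorm
  estimates.\<close>

lemma lip_norm_bounds:
  assumes "\<And>x y. \<bar>f x - f y\<bar> \<le> C * l1_dist I x y" "C \<ge> 0"
  shows "0 \<le> lip_norm I f" "lip_norm I f \<le> C"
proof -
  define S where "S = insert 0
     {\<bar>f x - f y\<bar> / l1_dist I x y | x y. x \<in> I \<rightarrow>\<^sub>E UNIV \<and> y \<in> I \<rightarrow>\<^sub>E UNIV \<and> x \<noteq> y}"
  have quotient: "\<bar>f x - f y\<bar> / l1_dist I x y \<le> C" for x y
  \<comment> \<open>At distance 0 the quotient is 0 by the convention for division by zero, so only
    \<open>C \<ge> 0\<close> is needed there.\<close>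
  proof (cases "l1_dist I x y = 0")
    case False
    have "l1_dist I x y \<ge> 0" by (simp add: l1_dist_def sum_nonneg)
    with False have "l1_dist I x y > 0" by simp
    then show ?thesis using assms(1) by (simp add: pos_divide_le_eq)
  qed (use assms(2) in simp)
  have ub: "s \<le> C" if "s \<in> S" for s
    using that quotient assms(2) by (auto simp: S_def)
  have "0 \<in> S" by (simp add: S_def)
  then have "0 \<le> Sup S" using ub by (intro cSup_upper bdd_aboveI) auto
  moreover have "Sup S \<le> C" using \<open>0 \<in> S\<close> ub by (intro cSup_least) auto
  ultimately show "0 \<le> lip_norm I f" "lip_norm I f \<le> C"
    by (simp_all add: lip_norm_def S_def)
qed

text \<open>For the l1 distance, summing the coordinates is 1-Lipschitz by the triangle inequality,
  so the constant does not grow with the size of \<open>I\<close>.\<close>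

lemma lipschitz_compose_sum:
  fixes h :: "real \<Rightarrow> real"
  assumes "\<And>a b. \<bar>h a - h b\<bar> \<le> \<bar>a - b\<bar>"
  shows "\<bar>h (t * (\<Sum>i\<in>I. x i)) - h (t * (\<Sum>i\<in>I. y i))\<bar> \<le> \<bar>t\<bar> * l1_dist I x y"
proof -
  have "\<bar>h (t * (\<Sum>i\<in>I. x i)) - h (t * (\<Sum>i\<in>I. y i))\<bar>
      \<le> \<bar>t * (\<Sum>i\<in>I. x i) - t * (\<Sum>i\<in>I. y i)\<bar>" by (rule assms)
  also have "\<dots> = \<bar>t\<bar> * \<bar>\<Sum>i\<in>I. x i - y i\<bar>"
    by (simp add: sum_subtractf abs_mult flip: right_diff_distrib)
  also have "\<dots> \<le> \<bar>t\<bar> * l1_dist I x y"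
    unfolding l1_dist_def by (intro mult_left_mono sum_abs) auto
  finally show ?thesis .
qed

lemma abs_sin_diff_le: "\<bar>sin a - sin b\<bar> \<le> \<bar>a - b\<bar>" for a b :: real
proof -
  have "\<bar>sin a - sin b\<bar> = 2 * \<bar>sin ((a - b) / 2)\<bar> * \<bar>cos ((a + b) / 2)\<bar>"
    by (simp add: sin_diff_sin abs_mult)
  also have "\<dots> \<le> 2 * \<bar>(a - b) / 2\<bar> * 1"
    by (intro mult_mono mult_left_mono abs_sin_x_le_abs_x) auto
  finally show ?thesis by simp
qed

lemma abs_cos_diff_le: "\<bar>cos a - cos b\<bar> \<le> \<bar>a - b\<bar>" for a b :: real
  using abs_sin_diff_le[of "pi / 2 - a" "pi / 2 - b"] by (simp add: sin_diff)

lemma (in prob_space) cov_eq: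
  assumes "cov_defined M U V"
  shows "cov M U V = (\<integral>\<omega>. U \<omega> * V \<omega> \<partial>M) - (\<integral>\<omega>. U \<omega> \<partial>M) * (\<integral>\<omega>. V \<omega> \<partial>M)"
  using assms by (simp add: cov_defined_def cov_def algebra_simps prob_space)

text \<open>The index \<open>True\<close> stands for the real part and \<open>False\<close> for the
  imaginary part. The unconjugated complex covariance is bilinear, so its real and imaginary parts
  each combine two real covariances; estimating the modulus by the sum of the absolute values of
  both parts produces the factor 4.\<close>

lemma (in prob_space) complex_cov_bound:
  fixes U V :: "bool \<Rightarrow> 'a \<Rightarrow> real"
  assumes "\<And>a b. cov_defined M (U a) (V b)" "\<And>a b. \<bar>cov M (U a) (V b)\<bar> \<le> K"
  defines "A \<equiv> \<lambda>\<omega>. Complex (U True \<omega>) (U False \<omega>)"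
    and "B \<equiv> \<lambda>\<omega>. Complex (V True \<omega>) (V False \<omega>)"
  shows "cmod ((\<integral>\<omega>. A \<omega> * B \<omega> \<partial>M) - (\<integral>\<omega>. A \<omega> \<partial>M) * (\<integral>\<omega>. B \<omega> \<partial>M)) \<le> 4 * K"
proof -
  \<comment> \<open>Integrability of each factor and of each product lets the simplifier split the
    integrals below by linearity.\<close>
  note [simp] = assms(1)[unfolded cov_defined_def, THEN conjunct1]
    assms(1)[unfolded cov_defined_def, THEN conjunct2, THEN conjunct1]
    assms(1)[unfolded cov_defined_def, THEN conjunct2, THEN conjunct2]
  have integral_Complex: "(\<integral>\<omega>. Complex (f \<omega>) (g \<omega>) \<partial>M) = Complex (\<integral>\<omega>. f \<omega> \<partial>M) (\<integral>\<omega>. g \<omega> \<partial>M)"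
    if "integrable M f" "integrable M g" for f g
    using that by (simp add: Complex_eq)
  have Complex_mult: "Complex a b * Complex c d = Complex (a * c - b * d) (a * d + b * c)"
    for a b c d by (simp add: complex_eq_iff)
  have Complex_diff: "Complex a b - Complex c d = Complex (a - c) (b - d)"
    for a b c d by (simp add: complex_eq_iff)
  let ?c = "\<lambda>a b. cov M (U a) (V b)"
  have "(\<integral>\<omega>. A \<omega> * B \<omega> \<partial>M) - (\<integral>\<omega>. A \<omega> \<partial>M) * (\<integral>\<omega>. B \<omega> \<partial>M)
      = Complex (?c True True - ?c False False) (?c True False + ?c False True)"
    by (simp add: A_def B_def Complex_mult Complex_diff integral_Complex cov_eq[OF assms(1)])
  also have "cmod \<dots> \<le> \<bar>?c True True - ?c False False\<bar> + \<bar>?c True False + ?c False True\<bar>"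
    using cmod_le[of "Complex (?c True True - ?c False False) (?c True False + ?c False True)"]
    by simp
  also have "\<dots> \<le> 4 * K"
    using assms(2)[of True True] assms(2)[of True False] assms(2)[of False True]
      assms(2)[of False False] by linarith
  finally show ?thesis .
qed

text \<open>The cosine and the sine of \<open>t\<close> times a block sum have seminorm at most
  \<open>\<bar>t\<bar>\<close>, one factor for each block; this is the source of
  \<open>t\<^sup>2\<close>.\<close>

lemma cis_sum_covariance_bound:
  fixes t :: real
  assumes M: "prob_space M" and \<gamma>: "\<And>k. k \<ge> 1 \<Longrightarrow> \<gamma> k \<ge> 0"
    and dep: "L_weakly_dependent M n X \<gamma>"
    and I: "I \<subseteq> {1..n}" and J: "J \<subseteq> {1..n}" and disj: "I \<inter> J = {}"
  defines "A \<equiv> \<lambda>\<omega>. cis (t * (\<Sum>i\<in>I. X i \<omega>))" and "B \<equiv> \<lambda>\<omega>. cis (t * (\<Sum>j\<in>J. X j \<omega>))"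
  shows "cmod ((\<integral>\<omega>. A \<omega> * B \<omega> \<partial>M) - (\<integral>\<omega>. A \<omega> \<partial>M) * (\<integral>\<omega>. B \<omega> \<partial>M))
    \<le> 4 * (t\<^sup>2 * (\<Sum>i\<in>I. \<Sum>j\<in>J. \<gamma> (nat \<bar>int j - int i\<bar>)))"
proof -
  define h :: "bool \<Rightarrow> real \<Rightarrow> real" where "h a = (if a then cos else sin)" for a
  define f where "f I a x = h a (t * (\<Sum>i\<in>I. x i))" for I a and x :: "nat \<Rightarrow> real"
  let ?U = "\<lambda>I a \<omega>. f I a (\<lambda>i\<in>I. X i \<omega>)"
  let ?G = "\<Sum>i\<in>I. \<Sum>j\<in>J. \<gamma> (nat \<bar>int j - int i\<bar>)"
  have lip: "\<bar>f I a x - f I a y\<bar> \<le> \<bar>t\<bar> * l1_dist I x y" for I a x y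
    unfolding f_def
    by (rule lipschitz_compose_sum) (simp add: h_def abs_cos_diff_le abs_sin_diff_le)
  then have l1_lip: "l1_lipschitz I (f I a)" for I a
    unfolding l1_lipschitz_def by blast
  have norms: "0 \<le> lip_norm I (f I a)" "lip_norm I (f I a) \<le> \<bar>t\<bar>" for I a
    using lip_norm_bounds[OF lip] by auto
  \<comment> \<open>Nonnegativity is known for lags at least 1 only; disjointness of the blocks
    excludes lag 0.\<close>
  have G: "?G \<ge> 0"
  proof (intro sum_nonneg \<gamma>)
    fix i j assume "i \<in> I" "j \<in> J"
    with disj have "i \<noteq> j" by auto
    then show "1 \<le> nat \<bar>int j - int i\<bar>" by linarith
  qed
  have U: "cov_defined M (?U I a) (?U J b)"
      "\<bar>cov M (?U I a) (?U J b)\<bar> \<le> lip_norm I (f I a) * lip_norm J (f J b) * ?G" for a b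
    using dep[unfolded L_weakly_dependent_def, rule_format, OF I J disj l1_lip l1_lip] by auto
  have "lip_norm I (f I a) * lip_norm J (f J b) * ?G \<le> \<bar>t\<bar> * \<bar>t\<bar> * ?G" for a b
    by (intro mult_right_mono[OF _ G] mult_mono norms) auto
  then have bound: "\<bar>cov M (?U I a) (?U J b)\<bar> \<le> t\<^sup>2 * ?G" for a b
    using order_trans[OF U(2)] by (simp add: power2_eq_square)
  \<comment> \<open>Restricting the vector to \<open>I\<close> does not change its sum over
    \<open>I\<close>.\<close>
  have "Complex (?U I True \<omega>) (?U I False \<omega>) = cis (t * (\<Sum>i\<in>I. X i \<omega>))" for I \<omega>
    by (simp add: f_def h_def complex_eq_iff)
  then show ?thesis
    using prob_space.complex_cov_bound[OF M, of "?U I" "?U J", OF U(1) bound]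
    by (simp add: A_def B_def)
qed

lemma (in prob_space) norm_integral_cis_le: "cmod (\<integral>\<omega>. cis (f \<omega>) \<partial>M) \<le> 1"
  using integral_norm_bound[of M "\<lambda>\<omega>. cis (f \<omega>)"] by (simp add: prob_space)

text \<open>The lag \<open>j\<close> is attained by exactly \<open>n - j\<close> pairs
  \<open>i < k\<close> in \<open>{1..n}\<close>. In the induction, the new index contributes each
  lag from 1 to \<open>n\<close> once.\<close>

lemma sum_lags_eq:
  fixes \<gamma> :: "nat \<Rightarrow> real"
  shows "(\<Sum>k=1..n. \<Sum>i=1..<k. \<gamma> (k - i)) = (\<Sum>j=1..n-1. real (n - j) * \<gamma> j)"
proof (induction n)
  case (Suc n)
  have "(\<Sum>i=1..<Suc n. \<gamma> (Suc n - i)) = (\<Sum>j=1..n. \<gamma> j)"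
    by (rule sum.reindex_bij_witness[of _ "\<lambda>j. Suc n - j" "\<lambda>i. Suc n - i"]) auto
  \<comment> \<open>The term at \<open>j = n\<close> has weight 0, so the range can be extended to
    match that of the next case.\<close>
  moreover have "(\<Sum>j=1..n-1. real (n - j) * \<gamma> j) = (\<Sum>j=1..n. real (n - j) * \<gamma> j)"
    by (rule sum.mono_neutral_left) auto
  moreover have "(\<Sum>j=1..n. real (Suc n - j) * \<gamma> j) = (\<Sum>j=1..n. real (n - j) * \<gamma> j + \<gamma> j)"
    by (rule sum.cong) (auto simp: Suc_diff_le algebra_simps)
  ultimately show ?case
    using Suc by (simp add: sum.distrib)
qed simp

theorem theorem14:
  fixes M :: "'a measure" and n :: nat and X :: "nat \<Rightarrow> 'a \<Rightarrow> real"
    and \<gamma> :: "nat \<Rightarrow> real" and t :: real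
  assumes "prob_space M"
    and "n \<ge> 2"
    and "\<And>j. j \<in> {1..n} \<Longrightarrow> X j \<in> borel_measurable M"
    and "\<And>j. j \<in> {1..n} \<Longrightarrow> integrable M (X j)"
    and "\<And>j. j \<in> {1..n} \<Longrightarrow> (\<integral>\<omega>. X j \<omega> \<partial>M) = 0"
    and "\<And>k. k \<ge> 1 \<Longrightarrow> \<gamma> k \<ge> 0"
    and "L_weakly_dependent M n X \<gamma>"
  shows "cmod ((\<integral>\<omega>. (\<Prod>j=1..n. exp (\<i> * of_real (t * X j \<omega>))) \<partial>M)
               - (\<Prod>j=1..n. \<integral>\<omega>. exp (\<i> * of_real (t * X j \<omega>)) \<partial>M))
         \<le> 4 * t\<^sup>2 * (\<Sum>j=1..n-1. real (n - j) * \<gamma> j)"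
proof -
  interpret prob_space M by fact
  \<comment> \<open>The bound is kept as a double sum because adjoining the variable with index
    \<open>k\<close> adds exactly the summand for \<open>k\<close>: the lags to its
    predecessors.\<close>
  have "cmod ((\<integral>\<omega>. cis (t * (\<Sum>j=1..m. X j \<omega>)) \<partial>M) - (\<Prod>j=1..m. \<integral>\<omega>. cis (t * X j \<omega>) \<partial>M))
      \<le> 4 * t\<^sup>2 * (\<Sum>k=1..m. \<Sum>i=1..<k. \<gamma> (k - i))" if "m \<le> n" for m
    using that
  proof (induction m)
    case 0
    then show ?case by (simp add: prob_space)
  next
    case (Suc m)
    let ?S = "\<lambda>\<omega>. cis (t * (\<Sum>j=1..m. X j \<omega>))"
    let ?Y = "\<lambda>\<omega>. cis (t * X (Suc m) \<omega>)"
    let ?P = "\<Prod>j=1..m. \<integral>\<omega>. cis (t * X j \<omega>) \<partial>M"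
    have "cmod ((\<integral>\<omega>. ?S \<omega> * ?Y \<omega> \<partial>M) - (\<integral>\<omega>. ?S \<omega> \<partial>M) * (\<integral>\<omega>. ?Y \<omega> \<partial>M))
        \<le> 4 * (t\<^sup>2 * (\<Sum>i=1..m. \<Sum>j\<in>{Suc m}. \<gamma> (nat \<bar>int j - int i\<bar>)))"
      using cis_sum_covariance_bound[OF assms(1,6,7), of "{1..m}" "{Suc m}" t] Suc.prems
      by simp
    also have "(\<Sum>i=1..m. \<Sum>j\<in>{Suc m}. \<gamma> (nat \<bar>int j - int i\<bar>)) = (\<Sum>i=1..<Suc m. \<gamma> (Suc m - i))"
    proof (rule sum.cong)
      fix i assume "i \<in> {1..<Suc m}"
      then have "nat \<bar>int (Suc m) - int i\<bar> = Suc m - i" by auto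
      then show "(\<Sum>j\<in>{Suc m}. \<gamma> (nat \<bar>int j - int i\<bar>)) = \<gamma> (Suc m - i)"
        by (simp only: sum.insert sum.empty finite.emptyI empty_iff not_False_eq_True add_0_right)
    qed auto
    finally have "cmod ((\<integral>\<omega>. ?S \<omega> * ?Y \<omega> \<partial>M) - (\<integral>\<omega>. ?S \<omega> \<partial>M) * (\<integral>\<omega>. ?Y \<omega> \<partial>M))
        \<le> 4 * t\<^sup>2 * (\<Sum>i=1..<Suc m. \<gamma> (Suc m - i))" by simp
    \<comment> \<open>The earlier error is multiplied by a characteristic function of modulus at
      most 1, so the induction hypothesis carries over without loss.\<close>
    moreover have "cmod (((\<integral>\<omega>. ?S \<omega> \<partial>M) - ?P) * (\<integral>\<omega>. ?Y \<omega> \<partial>M))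
        \<le> 4 * t\<^sup>2 * (\<Sum>k=1..m. \<Sum>i=1..<k. \<gamma> (k - i))"
      unfolding norm_mult using Suc.IH Suc.prems
      by (intro order_trans[OF mult_left_le[OF norm_integral_cis_le]]) auto
    moreover have "(\<integral>\<omega>. cis (t * (\<Sum>j=1..Suc m. X j \<omega>)) \<partial>M) = (\<integral>\<omega>. ?S \<omega> * ?Y \<omega> \<partial>M)"
      by (simp add: cis_mult distrib_left)
    \<comment> \<open>Insert the product of the integrals of \<open>?S\<close> and \<open>?Y\<close>
      between the two terms: the first difference is the covariance, the second the earlier error
      times the new factor.\<close>
    ultimately show ?case
      using norm_triangle_ineq[of "(\<integral>\<omega>. ?S \<omega> * ?Y \<omega> \<partial>M) - (\<integral>\<omega>. ?S \<omega> \<partial>M) * (\<integral>\<omega>. ?Y \<omega> \<partial>M)"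
          "((\<integral>\<omega>. ?S \<omega> \<partial>M) - ?P) * (\<integral>\<omega>. ?Y \<omega> \<partial>M)"]
      by (simp add: algebra_simps)
  qed
  from this[of n] have "cmod ((\<integral>\<omega>. cis (t * (\<Sum>j=1..n. X j \<omega>)) \<partial>M)
      - (\<Prod>j=1..n. \<integral>\<omega>. cis (t * X j \<omega>) \<partial>M))
      \<le> 4 * t\<^sup>2 * (\<Sum>k=1..n. \<Sum>i=1..<k. \<gamma> (k - i))" by simp
  moreover have "cis (t * (\<Sum>j=1..n. X j \<omega>)) = (\<Prod>j=1..n. cis (t * X j \<omega>))" for \<omega>
    by (simp add: cis_conv_exp exp_sum sum_distrib_left)
  ultimately show ?thesis
    by (simp only: cis_conv_exp[symmetric] sum_lags_eq[symmetric])
qed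

end
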